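(* Let $G=(V,E)$ be a finite directed acyclic network with source $s$ and sink set $T$, let $\omega\ge 1$ and $r\ge 0$ be integers with $n=\omega+r\le C_{\min}$, and let $\mathbb{F}_q$ be a finite field of order $q>|\mathscr{A}_r|$, where $\mathscr{A}_r$ is the set of primary edge subsets of $G$ of size $r$. Let $\mathcal{C}_n$ be an $n$-dimensional decodable linear network code over $\mathbb{F}_q$ on $G$ with global encoding kernels $\vec f_e^{\,(n)}\in\mathbb{F}_q^n$, $e\in E$, and let $Q^{(n)}=[\vec b_1^{\,(n)}\ \cdots\ \vec b_n^{\,(n)}]$ be an invertible $n\times n$ matrix over $\mathbb{F}_q$ such that $$\langle \vec b_i^{\,(n)}:1\le i\le\omega\rangle\cap\langle \vec f_e^{\,(n)}:e\in A\rangle=\{\vec 0\}\qquad\text{for all }A\in\mathscr{A}_r .$$ Write $b_{i,n}$ and $f_{e,n}$ for the last components of $\vec b_i^{\,(n)}$ and $\vec f_e^{\,(n)}$, and $\vec b_i^{\,(n-1)}$ and $\vec f_e^{\,(n-1)}$ for the vectors in $\mathbb{F}_q^{n-1}$ formed by their first $n-1$ components. Suppose that $\vec b_1^{\,(n-1)},\dots,\vec b_{\omega-1}^{\,(n-1)}$ are linearly independent. Put $\mathcal{B}_{\omega-1}^{(n-1)}=\langle \vec b_i^{\,(n-1)}:1\le i\le\omega-1\rangle$ and $\mathcal{L}_A^{(n-1)}=\langle \vec f_e^{\,(n-1)}:e\in A\rangle$. Let $\mathscr{A}_r'$ (resp. $\mathscr{A}_r''$) be the set of those $A\in\mathscr{A}_r$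 for which the $n-1$ vectors $\vec b_i^{\,(n-1)}$ ($1\le i\le\omega-1$), $\vec f_e^{\,(n-1)}$ ($e\in A$), are linearly dependent (resp. linearly independent), and for $A\in\mathscr{A}_r''$ let $$\mathcal{K}_A=\Big\{\sum_{i=1}^{\omega-1}\alpha_i\vec b_i^{\,(n-1)}+\sum_{e\in A}\beta_e\vec f_e^{\,(n-1)}:\ \alpha_i,\beta_e\in\mathbb{F}_q,\ \sum_{i=1}^{\omega-1}\alpha_ib_{i,n}+\sum_{e\in A}\beta_ef_{e,n}=-1\Big\}.$$ Then the set $$\mathbb{F}_q^{n-1}\setminus\Big[\bigcup_{A\in\mathscr{A}_r'}\big(\mathcal{B}_{\omega-1}^{(n-1)}+\mathcal{L}_A^{(n-1)}\big)\ \cup\bigcup_{A\in\mathscr{A}_r''}\mathcal{K}_A\Big]$$ is nonempty, and for every column vector $\vec\ell$ in this set, writing $\vec b_i^{\,(n-1)}(\vec\ell)=[I_{n-1}\ \ \vec\ell\,]\,\vec b_i^{\,(n)}$ and $\vec f_e^{\,(n-1)}(\vec\ell)=[I_{n-1}\ \ \vec\ell\,]\,\vec f_e^{\,(n)}$: (1) the vectors $\vec b_i^{\,(n-1)}(\vec\ell)$, $1\le i\le\omega-1$, are linearly independent; (2) $\langle \vec b_i^{\,(n-1)}(\vec\ell):1\le i\le\omega-1\rangle\cap\langle \vec f_e^{\,(n-1)}(\vec\ell):e\in A\rangle=\{\vec 0\}$ for all $A\in\mathscr{A}_r$.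
   Context: Network. $G=(V,E)$ is a finite directed acyclic graph (parallel edges allowed, each edge of capacity 1) with a single source $s$ having no incoming edges in $E$, and a nonempty set of sink nodes $T\subseteq V\setminus\{s\}$ having no outgoing edges. $\mathrm{In}(v)$, $\mathrm{Out}(v)$ are the sets of incoming and outgoing edges of $v$. For an $n$-dimensional code, $\mathrm{In}(s)=\{d_1,\dots,d_n\}$ is a set of $n$ imaginary incoming edges of $s$ (not in $E$). $C_t$ is the minimum cut capacity between $s$ and $t$ (least number of edges whose removal disconnects $s$ from $t$), and $C_{\min}=\min_{t\in T}C_t$. Linear network code. An $n$-dimensional $\mathbb{F}_q$-valued linear network code on $G$ is a collection $\mathcal{C}_n=\{K_v: v\in V\setminus T\}$ where $K_v=[k_{d,e}]_{d\in \mathrm{In}(v),e\in \mathrm{Out}(v)}$ is a matrix over $\mathbb{F}_q$ (the local encoding kernel at $v$). Its global encoding kernels $\vec f_e^{\,(n)}\in\mathbb{F}_q^n$ (column vectors) are defined recursively, along an ancestral (topological) order of edges, by $\vec f_e^{\,(n)}=\sum_{d\in\mathrm{In}(\mathrm{tail}(e))}k_{d,e}\vec f_d^{\,(n)}$, where $\vec f_{d_1}^{\,(n)},\dots,\vec f_{d_n}^{\,(n)}$ is the standard basis of $\mathbb{F}_q^n$. The code is decodable if for every $t\in T$ the matrix $[\vec f_e^{\,(n)}:e\in\mathrm{In}(t)]$ has rank $n$. Primary edge subsets. For $A\subseteq E$, a cut between $s$ and $A$ is a set of edges $C\subseteq E$ such that every directed path starting at $s$ whose last edge belongs to $A$ contains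 an edge of $C$ (the edges of $A$ themselves may be used in $C$); a minimum cut between $s$ and $A$ is one with the smallest number of edges. A minimum cut between $s$ and $A$ is called primary if it is also a cut between $s$ and every minimum cut between $s$ and $A$ (it separates $s$ from all minimum cuts between $s$ and $A$; such a minimum cut is unique). An edge subset $A$ is primary if $A$ is the primary minimum cut between $s$ and $A$ itself. $\mathscr{A}_r=\{A\subseteq E: A\text{ is primary and }|A|=r\}$. $\langle\cdot\rangle$ denotes linear span and $I_{n-1}$ is the $(n-1)\times(n-1)$ identity matrix. *)

theory Defs
  imports "Graph_Theory.Graph_Theory" "Jordan_Normal_Form.DL_Rank"
begin

abbreviation vspan :: "nat \<Rightarrow> 'q::field vec set \<Rightarrow> 'q vec set" where
  "vspan m S \<equiv> LinearCombinations.module.span class_ring (module_vec TYPE('q) m) S"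

abbreviation vlin_indpt :: "nat \<Rightarrow> 'q::field vec set \<Rightarrow> bool" where
  "vlin_indpt m S \<equiv> \<not> LinearCombinations.module.lin_dep class_ring (module_vec TYPE('q) m) S"

abbreviation vsum :: "nat \<Rightarrow> ('i \<Rightarrow> 'q::field vec) \<Rightarrow> 'i set \<Rightarrow> 'q vec" where
  "vsum m v I \<equiv> finsum_vec TYPE('q) m v I"

text \<open>Independence of an indexed family. Independence of the set of its values does not suffice:
  a family in which a vector is repeated is dependent.\<close>

definition lin_indpt_family :: "nat \<Rightarrow> ('i \<Rightarrow> 'q::field vec) \<Rightarrow> 'i set \<Rightarrow> bool" where
  "lin_indpt_family m v I \<longleftrightarrow> inj_on v I \<and> vlin_indpt m (v ` I)"

lemma finsum_vec_fundef_cong [fundef_cong]: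
  assumes "A = B" and "\<And>x. x \<in> B \<Longrightarrow> f x = g x"
  shows "finsum_vec ty m f A = finsum_vec ty m g B"
proof -
  have step: "(C, x) \<in> foldSetD D (h \<circ> k) e"
    if "(C, x) \<in> foldSetD D (h \<circ> l) e" "\<forall>y \<in> C. l y = k y"
    for C D e x k l and h :: "'b vec \<Rightarrow> 'b vec \<Rightarrow> 'b vec"
    using that
  proof (induction rule: foldSetD.induct)
    case emptyI
    then show ?case by (intro foldSetD.emptyI)
  next
    case (insertI x A y)
    then have "(insert x A, (h \<circ> k) x y) \<in> foldSetD D (h \<circ> k) e"
      by (intro foldSetD.insertI) auto
    moreover have "(h \<circ> l) x y = (h \<circ> k) x y"
      using insertI.prems by simp
    ultimately show ?case by (simp only:)
  qed
  have "(B, x) \<in> foldSetD D (h \<circ> f) e \<longleftrightarrow> (B, x) \<in> foldSetD D (h \<circ> g) e"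
    for D e x and h :: "'b vec \<Rightarrow> 'b vec \<Rightarrow> 'b vec"
    using step[of B x D h f e g] step[of B x D h g e f] assms(2) by auto
  then show ?thesis
    by (simp add: assms(1) finsum_vec_def finprod_def foldD_def)
qed

text \<open>The incoming edges seen by a code of dimension \<open>n\<close>: edges of the network, and the imaginary
  edges \<open>d\<^sub>1, \<dots>, d\<^sub>n\<close> entering the source, written \<open>Imag 0, \<dots>, Imag (n - 1)\<close>.\<close>

datatype 'e in_edge = Edge 'e | Imag nat

locale network = fin_digraph G for G :: "('v, 'e) pre_digraph" (structure) +
  fixes s :: 'v and T :: "'v set"
  assumes acyclic: "acyclic (arcs_ends G)"
    and source_in_verts: "s \<in> verts G"
    and source_no_in: "in_arcs G s = {}"
    and sinks_nonempty: "T \<noteq> {}"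
    and sinks_subset: "T \<subseteq> verts G - {s}"
    and sinks_no_out: "\<And>t. t \<in> T \<Longrightarrow> out_arcs G t = {}"
begin

definition cut_capacity :: "'v \<Rightarrow> nat" where
  "cut_capacity t =
    (LEAST k. \<exists>C \<subseteq> arcs G. card C = k \<and> \<not> s \<rightarrow>\<^sup>*\<^bsub>G\<lparr>arcs := arcs G - C\<rparr>\<^esub> t)"

definition min_cut_capacity :: nat where
  "min_cut_capacity = Min (cut_capacity ` T)"

text \<open>In \<open>is_cut A C\<close> and its successors, \<open>A\<close> is the edge set being separated from \<open>s\<close>.\<close>

definition is_cut :: "'e set \<Rightarrow> 'e set \<Rightarrow> bool" where
  "is_cut A C \<longleftrightarrow> C \<subseteq> arcs G \<and>
    (\<forall>p v. apath s p v \<and> p \<noteq> [] \<and> last p \<in> A \<longrightarrow> set p \<inter> C \<noteq> {})"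

definition is_min_cut :: "'e set \<Rightarrow> 'e set \<Rightarrow> bool" where
  "is_min_cut A C \<longleftrightarrow> is_cut A C \<and> (\<forall>C'. is_cut A C' \<longrightarrow> card C \<le> card C')"

definition is_primary_min_cut :: "'e set \<Rightarrow> 'e set \<Rightarrow> bool" where
  "is_primary_min_cut A C \<longleftrightarrow> is_min_cut A C \<and> (\<forall>C'. is_min_cut A C' \<longrightarrow> is_cut C' C)"

definition primary_sets :: "nat \<Rightarrow> 'e set set" where
  "primary_sets r = {A. A \<subseteq> arcs G \<and> is_primary_min_cut A A \<and> card A = r}"

definition code_in :: "nat \<Rightarrow> 'v \<Rightarrow> 'e in_edge set" where
  "code_in n v = (if v = s then Imag ` {..<n} else Edge ` in_arcs G v)"

text \<open>A code is given by its local kernels \<open>K v d e\<close>; only the entries with \<open>d \<in> code_in n v\<close> and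
  \<open>e \<in> out_arcs G v\<close> matter, so in particular only vertices outside \<open>T\<close>.\<close>

function global_kernel ::
  "nat \<Rightarrow> ('v \<Rightarrow> 'e in_edge \<Rightarrow> 'e \<Rightarrow> 'q::field) \<Rightarrow> 'e in_edge \<Rightarrow> 'q vec" where
  "global_kernel n K (Imag i) = unit_vec n i"
| "global_kernel n K (Edge e) =
    vsum n (\<lambda>d. K (tail G e) d e \<cdot>\<^sub>v global_kernel n K d) (code_in n (tail G e))"
  by pat_completeness auto
termination
proof -
  have "finite (arcs_ends G)"
    by (simp add: arcs_ends_def)
  then have "wf (arcs_ends G)"
    using acyclic by (rule finite_acyclic_wf)
  then have "wf (inv_image (arcs_ends G <*lex*> less_than)
      (\<lambda>(n :: nat, K :: 'v \<Rightarrow> 'e in_edge \<Rightarrow> 'e \<Rightarrow> 'q, d).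
        case d of Edge e \<Rightarrow> (tail G e, Suc 0) | Imag i \<Rightarrow> (s, 0)))"
    by (intro wf_inv_image wf_lex_prod wf_less_than)
  then show ?thesis
  proof (rule local.termination)
    fix n K e d assume "d \<in> code_in n (tail G e)"
    then show "((n, K, d), (n, K, Edge e)) \<in> inv_image (arcs_ends G <*lex*> less_than)
      (\<lambda>(n :: nat, K :: 'v \<Rightarrow> 'e in_edge \<Rightarrow> 'e \<Rightarrow> 'q, d).
        case d of Edge e \<Rightarrow> (tail G e, Suc 0) | Imag i \<Rightarrow> (s, 0))"
      by (auto simp: code_in_def arcs_ends_def arc_to_ends_def in_arcs_def intro!: image_eqI split: if_splits)
  qed
qed

text \<open>The matrix of the kernels entering a sink is defined only up to the order of its columns,
  which does not affect the rank; \<open>es\<close> ranges over the possible orders.\<close>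

definition decodable :: "nat \<Rightarrow> ('v \<Rightarrow> 'e in_edge \<Rightarrow> 'e \<Rightarrow> 'q::field) \<Rightarrow> bool" where
  "decodable n K \<longleftrightarrow> (\<forall>t \<in> T. \<forall>es. distinct es \<and> set es = in_arcs G t \<longrightarrow>
    vec_space.rank n (mat_of_cols n (map (\<lambda>e. global_kernel n K (Edge e)) es)) = n)"

end

end

(*
  Work in F_q^(n-1). For A in A'_r the sum of spans is a proper subspace. For A in A''_r the n-1
  vectors form a basis and K_A is an affine hyperplane (or empty). Hence every excluded set has at
  most q^(n-2) elements, and fewer than q of them cannot cover the space.

  Projecting by [I l] adds to each vector its last component times l. For A in A''_r this is
  an invertible linear map exactly when l lies outside K_A, so the basis stays independent. For A
  in A'_r, l lies outside the span of the truncated vectors, so an equation between projected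
  combinations lifts to the same equation in F_q^n, where the hypothesis on A applies.

  Conclusion (1) fails for suitable l if no A is available, so one also needs A_r to be nonempty:
  minimum cut sizes of subsets of In(t) take every value up to C_t, and the primary minimum cut of
  any edge set is a primary set.
*)
theory Submission
  imports Defs "Berlekamp_Zassenhaus.Berlekamp_Type_Based"
begin

section \<open>Linear combinations of finite families\<close>

text \<open>Coefficients belong to indices rather than to vectors, so equal vectors at different
  indices stay separate. The entries are plain sums, which avoids carrier conditions in the algebra
  below.\<close>

definition lin_comb :: "nat \<Rightarrow> ('i \<Rightarrow> 'q::field vec) \<Rightarrow> ('i \<Rightarrow> 'q) \<Rightarrow> 'i set \<Rightarrow> 'q vec" where
  "lin_comb m v a I = vec m (\<lambda>k. \<Sum>i\<in>I. a i * v i $ k)"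

lemma lin_comb_carrier [simp]: "lin_comb m v a I \<in> carrier_vec m"
  by (simp add: lin_comb_def)

lemma lin_comb_dim [simp]: "dim_vec (lin_comb m v a I) = m"
  by (simp add: lin_comb_def)

lemma lin_comb_index [simp]: "k < m \<Longrightarrow> lin_comb m v a I $ k = (\<Sum>i\<in>I. a i * v i $ k)"
  by (simp add: lin_comb_def)

lemma lin_comb_cong:
  "I = J \<Longrightarrow> (\<And>i. i \<in> J \<Longrightarrow> a i = b i) \<Longrightarrow> (\<And>i. i \<in> J \<Longrightarrow> v i = w i) \<Longrightarrow>
    lin_comb m v a I = lin_comb m w b J"
  by (simp add: lin_comb_def)

lemma lin_comb_diff:
  "lin_comb m v (\<lambda>i. a i - c i) I = lin_comb m v a I - lin_comb m v c I"
  by (intro eq_vecI) (simp_all add: algebra_simps sum_subtractf)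

lemma lin_comb_smult:
  "lin_comb m v (\<lambda>i. c * a i) I = c \<cdot>\<^sub>v lin_comb m v a I"
  by (intro eq_vecI) (simp_all add: algebra_simps sum_distrib_left)

lemma lin_comb_uminus:
  "lin_comb m v (\<lambda>i. - a i) I = - lin_comb m v a I"
  by (intro eq_vecI) (simp_all add: sum_negf)

lemma lin_comb_Plus:
  assumes "finite I" "finite J"
  shows "lin_comb m (case_sum v w) c (I <+> J) =
    lin_comb m v (c \<circ> Inl) I + lin_comb m w (c \<circ> Inr) J"
  using assms by (intro eq_vecI) (simp_all add: sum.Plus comp_def)

lemma vsum_eq_lin_comb:
  assumes "finite I" "v \<in> I \<rightarrow> carrier_vec m"
  shows "vsum m (\<lambda>i. a i \<cdot>\<^sub>v v i) I = lin_comb m v a I"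
proof (rule eq_vecI)
  have closed: "(\<lambda>i. a i \<cdot>\<^sub>v v i) \<in> I \<rightarrow> carrier_vec m"
    using assms(2) by auto
  then have "vsum m (\<lambda>i. a i \<cdot>\<^sub>v v i) I \<in> carrier_vec m"
    by (rule finsum_vec_closed)
  then show "dim_vec (vsum m (\<lambda>i. a i \<cdot>\<^sub>v v i) I) = dim_vec (lin_comb m v a I)"
    by simp
  fix k assume "k < dim_vec (lin_comb m v a I)"
  then have k: "k < m" by simp
  have entry: "(a i \<cdot>\<^sub>v v i) $ k = a i * v i $ k" if "i \<in> I" for i
  proof -
    from that have "v i \<in> carrier_vec m" using assms(2) by blast
    then show ?thesis using k by simp
  qed
  have "vsum m (\<lambda>i. a i \<cdot>\<^sub>v v i) I $ k = (\<Sum>i\<in>I. (a i \<cdot>\<^sub>v v i) $ k)"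
    by (rule index_finsum_vec[OF assms(1) k closed])
  also have "\<dots> = (\<Sum>i\<in>I. a i * v i $ k)"
    by (rule sum.cong[OF refl entry])
  finally show "vsum m (\<lambda>i. a i \<cdot>\<^sub>v v i) I $ k = lin_comb m v a I $ k"
    using k by simp
qed

text \<open>The family may repeat vectors. A combination over the image becomes one over indices by
  choosing one preimage per vector; conversely, the coefficients are summed over each fibre of
  \<open>v\<close>.\<close>

lemma span_image_eq_lin_comb:
  fixes v :: "'i \<Rightarrow> 'q::field vec"
  assumes "finite I" and v: "v \<in> I \<rightarrow> carrier_vec m"
  shows "vspan m (v ` I) = range (\<lambda>a. lin_comb m v a I)"
proof -
  interpret V: vec_space "TYPE('q)" m .
  have sub: "v ` I \<subseteq> carrier_vec m" using v by auto
  show ?thesis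
  proof (intro equalityI subsetI)
    fix x assume "x \<in> vspan m (v ` I)"
    then obtain a A where x: "x = V.lincomb a A" and A: "finite A" "A \<subseteq> v ` I"
      using V.in_spanE by blast
    then obtain J where J: "J \<subseteq> I" "inj_on v J" "A = v ` J"
      by (auto simp: subset_image_inj)
    have "x = lin_comb m v (\<lambda>i. if i \<in> J then a (v i) else 0) I"
    proof (rule eq_vecI)
      show "dim_vec x = dim_vec (lin_comb m v (\<lambda>i. if i \<in> J then a (v i) else 0) I)"
        using V.lincomb_dim[OF A(1) order_trans[OF A(2) sub], of a] by (simp add: x)
      fix k assume "k < dim_vec (lin_comb m v (\<lambda>i. if i \<in> J then a (v i) else 0) I)"
      then have k: "k < m" by simp
      have "x $ k = (\<Sum>w\<in>A. a w * w $ k)"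
        unfolding x using k A sub by (intro V.lincomb_index) auto
      also have "\<dots> = (\<Sum>i\<in>J. a (v i) * v i $ k)"
        using J by (simp add: sum.reindex)
      also have "\<dots> = (\<Sum>i\<in>I. (if i \<in> J then a (v i) else 0) * v i $ k)"
        using assms(1) J(1) by (intro sum.mono_neutral_cong_left) auto
      finally show "x $ k = lin_comb m v (\<lambda>i. if i \<in> J then a (v i) else 0) I $ k"
        using k by simp
    qed
    then show "x \<in> range (\<lambda>a. lin_comb m v a I)" by simp
  next
    fix x assume "x \<in> range (\<lambda>a. lin_comb m v a I)"
    then obtain a where x: "x = lin_comb m v a I" by auto
    define c where "c w = (\<Sum>i\<in>{i\<in>I. v i = w}. a i)" for w
    have "x = V.lincomb c (v ` I)"
    proof (rule eq_vecI)
      show "dim_vec x = dim_vec (V.lincomb c (v ` I))"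
        using V.lincomb_dim[OF finite_imageI[OF assms(1)] sub] by (simp add: x)
      fix k assume "k < dim_vec (V.lincomb c (v ` I))"
      then have k: "k < m"
        using V.lincomb_dim[OF finite_imageI[OF assms(1)] sub] by simp
      have "x $ k = (\<Sum>w\<in>v ` I. \<Sum>i\<in>{i\<in>I. v i = w}. a i * v i $ k)"
        using k assms(1) by (simp add: x sum.image_gen[of I _ v])
      also have "\<dots> = (\<Sum>w\<in>v ` I. c w * w $ k)"
        unfolding c_def sum_distrib_right by (intro sum.cong) auto
      also have "\<dots> = V.lincomb c (v ` I) $ k"
        using k sub by (subst V.lincomb_index) auto
      finally show "x $ k = V.lincomb c (v ` I) $ k" .
    qed
    then show "x \<in> vspan m (v ` I)"
      using assms(1) by (intro V.in_spanI) auto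
  qed
qed

text \<open>Injectivity turns combinations over the image into combinations over the indices. In the
  other direction, a repeated vector would give a nontrivial relation.\<close>

lemma lin_indpt_family_iff_lin_comb:
  fixes v :: "'i \<Rightarrow> 'q::field vec"
  assumes "finite I" and v: "v \<in> I \<rightarrow> carrier_vec m"
  shows "lin_indpt_family m v I \<longleftrightarrow>
    (\<forall>a. lin_comb m v a I = 0\<^sub>v m \<longrightarrow> (\<forall>i\<in>I. a i = 0))"
proof -
  interpret V: vec_space "TYPE('q)" m .
  have sub: "v ` I \<subseteq> carrier_vec m" using v by auto
  have lincomb_eq: "V.lincomb c (v ` I) = lin_comb m v (c \<circ> v) I" if "inj_on v I" for c
  proof (rule eq_vecI)
    show "dim_vec (V.lincomb c (v ` I)) = dim_vec (lin_comb m v (c \<circ> v) I)"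
      using V.lincomb_dim[OF finite_imageI[OF assms(1)] sub] by simp
    fix k assume "k < dim_vec (lin_comb m v (c \<circ> v) I)"
    then have k: "k < m" by simp
    have "V.lincomb c (v ` I) $ k = (\<Sum>w\<in>v ` I. c w * w $ k)"
      using k v by (intro V.lincomb_index) auto
    then show "V.lincomb c (v ` I) $ k = lin_comb m v (c \<circ> v) I $ k"
      using k that by (simp add: sum.reindex)
  qed
  have lin_dep_iff: "V.lin_dep (v ` I) \<longleftrightarrow> (\<exists>c. V.lincomb c (v ` I) = 0\<^sub>v m \<and> (\<exists>w\<in>v ` I. c w \<noteq> 0))"
  proof
    assume "V.lin_dep (v ` I)"
    with assms(1) sub show "\<exists>c. V.lincomb c (v ` I) = 0\<^sub>v m \<and> (\<exists>w\<in>v ` I. c w \<noteq> 0)"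
      using V.finite_lin_dep[of "v ` I"] by auto
  next
    assume "\<exists>c. V.lincomb c (v ` I) = 0\<^sub>v m \<and> (\<exists>w\<in>v ` I. c w \<noteq> 0)"
    then obtain c w where "V.lincomb c (v ` I) = 0\<^sub>v m" "w \<in> v ` I" "c w \<noteq> 0" by blast
    then show "V.lin_dep (v ` I)"
      using assms(1) by (intro V.lin_dep_crit[where A = "v ` I" and a = c and v = w]) auto
  qed
  show ?thesis
  proof
    assume indpt: "lin_indpt_family m v I"
    then have inj: "inj_on v I" and nd: "\<not> V.lin_dep (v ` I)"
      by (simp_all add: lin_indpt_family_def)
    show "\<forall>a. lin_comb m v a I = 0\<^sub>v m \<longrightarrow> (\<forall>i\<in>I. a i = 0)"
    proof (intro allI impI)
      fix a assume zero: "lin_comb m v a I = 0\<^sub>v m"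
      have "lin_comb m v ((a \<circ> the_inv_into I v) \<circ> v) I = lin_comb m v a I"
        by (intro lin_comb_cong) (auto simp: the_inv_into_f_f[OF inj])
      then have "V.lincomb (a \<circ> the_inv_into I v) (v ` I) = 0\<^sub>v m"
        using zero lincomb_eq[OF inj] by simp
      then have "\<forall>w\<in>v ` I. (a \<circ> the_inv_into I v) w = 0"
        using nd lin_dep_iff by blast
      then show "\<forall>i\<in>I. a i = 0"
        by (simp add: the_inv_into_f_f[OF inj])
    qed
  next
    assume zero: "\<forall>a. lin_comb m v a I = 0\<^sub>v m \<longrightarrow> (\<forall>i\<in>I. a i = 0)"
    have inj: "inj_on v I"
    proof (intro inj_onI, rule ccontr)
      fix i j assume ij: "i \<in> I" "j \<in> I" "v i = v j" "i \<noteq> j"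
      \<comment> \<open>The relation \<open>v i - v j = 0\<close>, with all other coefficients
        zero.\<close>
      define a where "a k = (if k = i then 1 else if k = j then - 1 else (0::'q))" for k
      have "lin_comb m v a I = 0\<^sub>v m"
      proof (rule eq_vecI)
        fix k assume "k < dim_vec (0\<^sub>v m :: 'q vec)"
        then have k: "k < m" by simp
        have "(\<Sum>l\<in>I. a l * v l $ k) = (\<Sum>l\<in>{i, j}. a l * v l $ k)"
          using assms(1) ij by (intro sum.mono_neutral_right) (auto simp: a_def)
        also have "\<dots> = 0" using ij by (simp add: a_def)
        finally show "lin_comb m v a I $ k = 0\<^sub>v m $ k" using k by simp
      qed simp
      then have "a i = 0" using zero ij by blast
      then show False by (simp add: a_def)
    qed
    have "\<not> V.lin_dep (v ` I)"
    proof
      assume "V.lin_dep (v ` I)"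
      then obtain c where "V.lincomb c (v ` I) = 0\<^sub>v m" "\<exists>w\<in>v ` I. c w \<noteq> 0"
        using lin_dep_iff by blast
      then show False using zero lincomb_eq[OF inj] by force
    qed
    with inj show "lin_indpt_family m v I" by (simp add: lin_indpt_family_def)
  qed
qed

lemma lin_comb_add_smult:
  assumes "v \<in> I \<rightarrow> carrier_vec m" "l \<in> carrier_vec m"
  shows "lin_comb m (\<lambda>i. v i + c i \<cdot>\<^sub>v l) a I = lin_comb m v a I + (\<Sum>i\<in>I. a i * c i) \<cdot>\<^sub>v l"
proof (rule eq_vecI)
  fix k assume "k < dim_vec (lin_comb m v a I + (\<Sum>i\<in>I. a i * c i) \<cdot>\<^sub>v l)"
  then have k: "k < m" using assms(2) by simp
  have entry: "a i * (v i + c i \<cdot>\<^sub>v l) $ k = a i * v i $ k + a i * c i * l $ k" if "i \<in> I" for i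
  proof -
    from that have "v i \<in> carrier_vec m" using assms(1) by blast
    then show ?thesis using k assms(2) by (simp add: algebra_simps)
  qed
  have "lin_comb m (\<lambda>i. v i + c i \<cdot>\<^sub>v l) a I $ k = (\<Sum>i\<in>I. a i * (v i + c i \<cdot>\<^sub>v l) $ k)"
    by (rule lin_comb_index[OF k])
  also have "\<dots> = (\<Sum>i\<in>I. a i * v i $ k + a i * c i * l $ k)"
    by (rule sum.cong[OF refl entry])
  finally show "lin_comb m (\<lambda>i. v i + c i \<cdot>\<^sub>v l) a I $ k =
      (lin_comb m v a I + (\<Sum>i\<in>I. a i * c i) \<cdot>\<^sub>v l) $ k"
    using k assms(2) by (simp add: sum.distrib sum_distrib_right)
qed (use assms(2) in simp)

section \<open>Counting combinations over a finite field\<close>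

text \<open>One coefficient is not free, so there are at most q^(|I|-1) values. Multiplying by q
  keeps subtraction out of the exponent.\<close>

lemma card_le_free_coefficients:
  fixes F :: "('i \<Rightarrow> 'q::finite) \<Rightarrow> 'a"
  assumes "finite I" "j \<in> I" and X: "X \<subseteq> F ` ((I - {j}) \<rightarrow>\<^sub>E UNIV)"
  shows "card X * CARD('q) \<le> CARD('q) ^ card I"
proof -
  let ?P = "(I - {j}) \<rightarrow>\<^sub>E (UNIV :: 'q set)"
  have "finite ?P" using assms(1) by (intro finite_PiE) auto
  then have "card X \<le> card ?P" using X surj_card_le by blast
  also have "\<dots> = CARD('q) ^ (card I - 1)"
    using assms(1,2) by (subst card_PiE) auto
  finally have "card X * CARD('q) \<le> CARD('q) ^ (card I - 1) * CARD('q)" by simp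
  also have "\<dots> = CARD('q) ^ card I"
    using assms(1,2) card_gt_0_iff[of I] by (cases "card I") auto
  finally show ?thesis .
qed

text \<open>A relation \<open>c\<close> with \<open>c j \<noteq> 0\<close> eliminates index
  \<open>j\<close>: subtracting \<open>a j / c j\<close> times the relation leaves the vector
  unchanged and makes its coefficient at \<open>j\<close> zero.\<close>

lemma card_range_lin_comb_dependent:
  fixes v :: "'i \<Rightarrow> 'q::{field, finite} vec"
  assumes "finite I" "v \<in> I \<rightarrow> carrier_vec m" "\<not> lin_indpt_family m v I"
  shows "card (range (\<lambda>a. lin_comb m v a I)) * CARD('q) \<le> CARD('q) ^ card I"
proof -
  obtain c j where c: "lin_comb m v c I = 0\<^sub>v m" and j: "j \<in> I" "c j \<noteq> 0"
    using assms lin_indpt_family_iff_lin_comb by blast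
  have "lin_comb m v a I \<in> (\<lambda>a. lin_comb m v (a(j := 0)) I) ` ((I - {j}) \<rightarrow>\<^sub>E UNIV)" for a
  proof (rule image_eqI)
    let ?a = "\<lambda>i. a i - a j / c j * c i"
    have "lin_comb m v a I = lin_comb m v ?a I"
      unfolding lin_comb_diff lin_comb_smult c by (intro eq_vecI) auto
    also have "\<dots> = lin_comb m v ((restrict ?a (I - {j}))(j := 0)) I"
      using j by (intro lin_comb_cong) auto
    finally show "lin_comb m v a I = lin_comb m v ((restrict ?a (I - {j}))(j := 0)) I" .
  qed simp
  then show ?thesis
    using assms(1) j(1) by (intro card_le_free_coefficients[where j = j]) auto
qed

text \<open>If some \<open>c j \<noteq> 0\<close>, the affine equation determines the coefficient at
  \<open>j\<close> from the others. If all \<open>c i\<close> vanish, the equation has no solution,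
  as \<open>d \<noteq> 0\<close>.\<close>

lemma card_lin_comb_hyperplane:
  fixes v :: "'i \<Rightarrow> 'q::{field, finite} vec"
  assumes "finite I" "d \<noteq> 0"
  shows "card {lin_comb m v a I | a. (\<Sum>i\<in>I. a i * c i) = d} * CARD('q) \<le> CARD('q) ^ card I"
proof (cases "\<forall>i\<in>I. c i = 0")
  case True
  then have "{lin_comb m v a I | a. (\<Sum>i\<in>I. a i * c i) = d} = {}"
    using assms(2) by auto
  then show ?thesis by (simp only: card.empty)
next
  case False
  then obtain j where j: "j \<in> I" "c j \<noteq> 0" by blast
  define F where
    "F a = lin_comb m v (a(j := (d - (\<Sum>i\<in>I - {j}. a i * c i)) / c j)) I" for a
  have "lin_comb m v a I \<in> F ` ((I - {j}) \<rightarrow>\<^sub>E UNIV)" if "(\<Sum>i\<in>I. a i * c i) = d" for a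
  proof (rule image_eqI)
    have "d = a j * c j + (\<Sum>i\<in>I - {j}. a i * c i)"
      using that sum.remove[OF assms(1) j(1), of "\<lambda>i. a i * c i"] by simp
    then have "a j = (d - (\<Sum>i\<in>I - {j}. restrict a (I - {j}) i * c i)) / c j"
      using j(2) by simp
    then show "lin_comb m v a I = F (restrict a (I - {j}))"
      unfolding F_def by (intro lin_comb_cong) auto
  qed simp
  then show ?thesis
    using assms(1) j(1) by (intro card_le_free_coefficients[where j = j and F = F]) auto
qed

section \<open>Adding multiples of a fixed vector to a family\<close>

text \<open>By independence, distinct coefficient functions give distinct vectors. There are as many
  functions as vectors in the space, so every vector occurs.\<close>

lemma lin_indpt_family_spans:
  fixes v :: "'i \<Rightarrow> 'q::{field, finite} vec"
  assumes "finite I" "v \<in> I \<rightarrow> carrier_vec (card I)" "lin_indpt_family (card I) v I"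
    and "l \<in> carrier_vec (card I)"
  obtains a where "l = lin_comb (card I) v a I"
proof -
  let ?P = "I \<rightarrow>\<^sub>E (UNIV :: 'q set)" and ?F = "\<lambda>a. lin_comb (card I) v a I"
  have "inj_on ?F ?P"
  proof (rule inj_onI)
    fix a c assume a: "a \<in> ?P" and c: "c \<in> ?P" and "?F a = ?F c"
    then have "lin_comb (card I) v (\<lambda>i. a i - c i) I = 0\<^sub>v (card I)"
      by (simp add: lin_comb_diff minus_cancel_vec)
    then have "\<forall>i\<in>I. a i = c i"
      using assms(1-3) lin_indpt_family_iff_lin_comb[of I v] by fastforce
    with a c show "a = c" by (auto intro: PiE_ext)
  qed
  then have "card (?F ` ?P) = CARD('q) ^ card I"
    using assms(1) by (simp add: card_image card_PiE)
  then have "?F ` ?P = carrier_vec (card I)"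
    by (intro card_subset_eq) (auto simp: card_carrier_vec)
  then have "l \<in> ?F ` ?P" using assms(4) by simp
  then show thesis using that by blast
qed

text \<open>The linear map \<open>x \<mapsto> x + \<phi> x \<cdot> l\<close>, where \<open>\<phi>\<close> sends \<open>v i\<close> to \<open>c i\<close>, is invertible
  unless \<open>\<phi> l = -1\<close>.\<close>

lemma lin_indpt_family_add_smult:
  fixes v :: "'i \<Rightarrow> 'q::{field, finite} vec"
  assumes "finite I" "v \<in> I \<rightarrow> carrier_vec m" "card I = m" "lin_indpt_family m v I"
    and l: "l \<in> carrier_vec m" "l \<notin> {lin_comb m v a I | a. (\<Sum>i\<in>I. a i * c i) = - 1}"
  shows "lin_indpt_family m (\<lambda>i. v i + c i \<cdot>\<^sub>v l) I"
proof -
  have closed: "(\<lambda>i. v i + c i \<cdot>\<^sub>v l) \<in> I \<rightarrow> carrier_vec m"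
    using assms(2) l(1) by (simp add: Pi_iff)
  have indpt: "a i = 0" if "lin_comb m v a I = 0\<^sub>v m" "i \<in> I" for a i
    using that assms(1,2,4) lin_indpt_family_iff_lin_comb by blast
  obtain g where g: "l = lin_comb m v g I"
    using lin_indpt_family_spans[of I v l] assms by metis
  have "\<forall>i\<in>I. a i = 0" if "lin_comb m (\<lambda>i. v i + c i \<cdot>\<^sub>v l) a I = 0\<^sub>v m" for a
  proof -
    \<comment> \<open>The vanishing combination reads: the combination of \<open>v\<close> with
      coefficients \<open>a\<close> equals -s l. Comparing coordinates in the basis \<open>v\<close>
      gives \<open>a i = - s * g i\<close>; substituting this into the definition of
      \<open>s\<close> gives s (1 + \<phi> l) = 0.\<close>
    define s where "s = (\<Sum>i\<in>I. a i * c i)"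
    have "lin_comb m v (\<lambda>i. a i - (- s) * g i) I = lin_comb m v a I - (- s) \<cdot>\<^sub>v l"
      by (simp only: lin_comb_diff lin_comb_smult g)
    also have "\<dots> = lin_comb m v a I + s \<cdot>\<^sub>v l"
      using l(1) by (intro eq_vecI) auto
    also have "\<dots> = 0\<^sub>v m"
      using that assms(2) l(1) by (simp add: lin_comb_add_smult s_def)
    finally have zero: "lin_comb m v (\<lambda>i. a i - (- s) * g i) I = 0\<^sub>v m" .
    have a: "a i = - s * g i" if "i \<in> I" for i
    proof -
      have "a i - (- s) * g i = 0" using indpt[OF zero that] .
      then show ?thesis by (simp add: eq_neg_iff_add_eq_0)
    qed
    have "s = (\<Sum>i\<in>I. - s * (g i * c i))"
      by (subst s_def, intro sum.cong refl) (simp add: a)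
    then have "s = - (s * (\<Sum>i\<in>I. g i * c i))"
      by (simp add: sum_distrib_left sum_negf)
    then have "s + s * (\<Sum>i\<in>I. g i * c i) = 0"
      using eq_neg_iff_add_eq_0 by blast
    then have "s * (1 + (\<Sum>i\<in>I. g i * c i)) = 0" by (simp add: distrib_left)
    moreover have "(\<Sum>i\<in>I. g i * c i) \<noteq> - 1" using l(2) g by blast
    then have "1 + (\<Sum>i\<in>I. g i * c i) \<noteq> 0" by (metis add_eq_0_iff)
    ultimately have "s = 0" by simp
    with a show ?thesis by simp
  qed
  then show ?thesis
    using assms(1) closed by (simp add: lin_indpt_family_iff_lin_comb)
qed

text \<open>If the total multiple of \<open>l\<close> were nonzero, dividing by it would express
  \<open>l\<close> through the family. Hence it vanishes, and only the combination of
  \<open>v\<close> remains.\<close>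

lemma lin_comb_add_smult_eq_zeroD:
  fixes v :: "'i \<Rightarrow> 'q::field vec"
  assumes "v \<in> I \<rightarrow> carrier_vec m" "l \<in> carrier_vec m" "l \<notin> range (\<lambda>a. lin_comb m v a I)"
    and zero: "lin_comb m (\<lambda>i. v i + c i \<cdot>\<^sub>v l) a I = 0\<^sub>v m"
  shows "lin_comb m v a I = 0\<^sub>v m" "(\<Sum>i\<in>I. a i * c i) = 0"
proof -
  define s where "s = (\<Sum>i\<in>I. a i * c i)"
  have eq: "lin_comb m v a I + s \<cdot>\<^sub>v l = 0\<^sub>v m"
    using zero lin_comb_add_smult[OF assms(1,2)] by (simp add: s_def)
  have s: "s = 0"
  proof (rule ccontr)
    assume "s \<noteq> 0"
    have "lin_comb m v (\<lambda>i. - inverse s * a i) I = l"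
    proof (rule eq_vecI)
      fix k assume "k < dim_vec l"
      then have k: "k < m" using assms(2) by simp
      have "lin_comb m v a I $ k + s * l $ k = (lin_comb m v a I + s \<cdot>\<^sub>v l) $ k"
        using k assms(2) by (simp del: lin_comb_index)
      also have "\<dots> = 0" using k by (simp add: eq)
      finally have "lin_comb m v a I $ k = - s * l $ k"
        by (simp add: eq_neg_iff_add_eq_0)
      then show "lin_comb m v (\<lambda>i. - inverse s * a i) I $ k = l $ k"
        unfolding lin_comb_smult using k \<open>s \<noteq> 0\<close> by (simp del: lin_comb_index)
    qed (use assms(2) in simp)
    then show False using assms(3) by blast
  qed
  then show "(\<Sum>i\<in>I. a i * c i) = 0" by (simp add: s_def)
  have zero_smult: "0 \<cdot>\<^sub>v l = 0\<^sub>v m"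
    using assms(2) by (intro eq_vecI) auto
  show "lin_comb m v a I = 0\<^sub>v m"
    using eq right_zero_vec[OF lin_comb_carrier] by (simp add: s zero_smult)
qed

text \<open>A union bound: each set has at most the fraction 1/q of the space, and there are fewer
  than q sets.\<close>

lemma carrier_vec_not_covered:
  fixes X :: "'i \<Rightarrow> 'q::finite vec set"
  assumes "finite \<A>" "card \<A> < CARD('q)"
    and "\<And>A. A \<in> \<A> \<Longrightarrow> card (X A) * CARD('q) \<le> CARD('q) ^ m"
    and "\<And>A. A \<in> \<A> \<Longrightarrow> X A \<subseteq> carrier_vec m"
  shows "carrier_vec m - (\<Union>A\<in>\<A>. X A) \<noteq> {}"
proof
  assume "carrier_vec m - (\<Union>A\<in>\<A>. X A) = {}"
  then have eq: "(\<Union>A\<in>\<A>. X A) = carrier_vec m" using assms(4) by blast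
  have "CARD('q) ^ m * CARD('q) = card (\<Union>A\<in>\<A>. X A) * CARD('q)"
    by (simp only: eq card_carrier_vec)
  also have "\<dots> \<le> (\<Sum>A\<in>\<A>. card (X A)) * CARD('q)"
    using card_UN_le[OF assms(1)] by (intro mult_right_mono) auto
  also have "\<dots> \<le> (\<Sum>A\<in>\<A>. CARD('q) ^ m)"
    unfolding sum_distrib_right by (intro sum_mono assms(3))
  also have "\<dots> = card \<A> * CARD('q) ^ m" by simp
  also have "\<dots> < CARD('q) * CARD('q) ^ m"
    using assms(2) by (intro mult_strict_right_mono) auto
  finally show False by (simp add: mult.commute)
qed

lemma mat_of_cols_one_append_mult_vec:
  fixes l w :: "'q::field vec"
  assumes "l \<in> carrier_vec m" "w \<in> carrier_vec (Suc m)"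
  shows "mat_of_cols m (cols (1\<^sub>m m) @ [l]) *\<^sub>v w = vec_first w m + w $ m \<cdot>\<^sub>v l"
proof (rule eq_vecI)
  fix k assume "k < dim_vec (vec_first w m + w $ m \<cdot>\<^sub>v l)"
  then have k: "k < m" using assms(1) by simp
  let ?c = "cols (1\<^sub>m m :: 'q mat) @ [l]"
  have "(mat_of_cols m ?c *\<^sub>v w) $ k = (\<Sum>j<Suc m. ?c ! j $ k * w $ j)"
    using k assms(2) by (auto simp: scalar_prod_def mat_of_cols_index lessThan_atLeast0 intro!: sum.cong)
  also have "\<dots> = (\<Sum>j<m. ?c ! j $ k * w $ j) + l $ k * w $ m"
    by (simp add: nth_append)
  also have "(\<Sum>j<m. ?c ! j $ k * w $ j) = (\<Sum>j<m. if j = k then w $ j else 0)"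
    using k by (intro sum.cong) (auto simp: nth_append)
  finally show "(mat_of_cols m ?c *\<^sub>v w) $ k = (vec_first w m + w $ m \<cdot>\<^sub>v l) $ k"
    using k assms(1) by (simp add: vec_first_def mult.commute)
qed (use assms(1) in simp)

section \<open>Primary edge sets\<close>

context network
begin

section \<open>Walks and cuts\<close>

text \<open>A repeated vertex would close a directed cycle. Cuts can thus be tested on walks, which
  may be concatenated without checking that vertices stay distinct.\<close>

lemma awalk_imp_apath: "awalk u p v \<Longrightarrow> apath u p v"
proof (induction p arbitrary: u)
  case Nil
  then show ?case by (auto simp: awalk_Nil_iff apath_Nil_iff)
next
  case (Cons e p)
  then have e: "e \<in> arcs G" "u = tail G e" and p: "awalk (head G e) p v"
    by (simp_all add: awalk_Cons_iff)
  have "tail G e \<notin> set (awalk_verts (head G e) p)"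
  proof
    assume "tail G e \<in> set (awalk_verts (head G e) p)"
    then have "head G e \<rightarrow>\<^sup>* tail G e"
      using p by (auto dest: awalk_verts_reachable_from)
    with e have "tail G e \<rightarrow>\<^sup>+ tail G e"
      by (metis in_arcs_imp_in_arcs_ends reachable1_reachable_trans r_into_trancl')
    then show False using acyclic by (simp add: acyclic_def)
  qed
  with Cons e p show ?case by (simp add: apath_Cons_iff)
qed

lemma apath_iff_awalk: "apath u p v \<longleftrightarrow> awalk u p v"
  using awalk_imp_apath awalkI_apath by blast

lemma is_cutD:
  assumes "is_cut A C" "awalk s p v" "p \<noteq> []" "last p \<in> A"
  shows "set p \<inter> C \<noteq> {}"
  using assms unfolding is_cut_def apath_iff_awalk by blast

lemma is_cutI:
  assumes "C \<subseteq> arcs G"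
    and "\<And>p v. awalk s p v \<Longrightarrow> p \<noteq> [] \<Longrightarrow> last p \<in> A \<Longrightarrow> set p \<inter> C \<noteq> {}"
  shows "is_cut A C"
  using assms unfolding is_cut_def apath_iff_awalk by blast

lemma is_cut_subset: "is_cut A C \<Longrightarrow> C \<subseteq> arcs G"
  by (simp add: is_cut_def)

lemma finite_cut: "is_cut A C \<Longrightarrow> finite C"
  using is_cut_subset finite_subset finite_arcs by blast

lemma is_cut_refl: "A \<subseteq> arcs G \<Longrightarrow> is_cut A A"
  by (rule is_cutI) (use last_in_set in blast)+

text \<open>A walk into \<open>A\<close> uses an edge of \<open>B\<close>; its prefix ending with
  that edge is a walk into \<open>B\<close> and so already meets \<open>C\<close>.\<close>

lemma is_cut_trans:
  assumes "is_cut A B" "is_cut B C"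
  shows "is_cut A C"
proof (rule is_cutI)
  show "C \<subseteq> arcs G" using assms(2) by (rule is_cut_subset)
next
  fix p v assume p: "awalk s p v" "p \<noteq> []" "last p \<in> A"
  then obtain e where e: "e \<in> set p" "e \<in> B" using is_cutD[OF assms(1) p] by blast
  then obtain q q' where pq: "p = (q @ [e]) @ q'" by (auto dest: split_list)
  then have "awalk s (q @ [e]) (awlast s (q @ [e]))"
    using p(1) awalk_append_iff by blast
  then have "set (q @ [e]) \<inter> C \<noteq> {}" using e by (intro is_cutD[OF assms(2)]) auto
  then show "set p \<inter> C \<noteq> {}" by (auto simp: pq)
qed

lemma is_min_cut_exists:
  assumes "A \<subseteq> arcs G"
  obtains C where "is_min_cut A C"
  using ex_has_least_nat[of "is_cut A" A card] is_cut_refl[OF assms] that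
  by (auto simp: is_min_cut_def)

section \<open>Uncrossing and primary minimum cuts\<close>

text \<open>Uncrossing. Among the edges of \<open>C \<union> D\<close>, let \<open>X\<close> be those that come first on some walk
  from \<open>s\<close>, and \<open>Y\<close> those that come last on some walk into \<open>A\<close>. Both are cuts, and an edge in
  both lies in \<open>C \<inter> D\<close>, so \<open>|X| + |Y| \<le> |C| + |D|\<close>.\<close>

lemma min_cut_uncross:
  assumes C: "is_min_cut A C" and D: "is_min_cut A D"
  obtains X where "is_min_cut A X" "is_cut C X" "is_cut D X"
proof -
  have cutC: "is_cut A C" and cutD: "is_cut A D" using C D by (simp_all add: is_min_cut_def)
  then have fin: "finite C" "finite D" by (simp_all add: finite_cut)
  let ?U = "C \<union> D"
  define X where "X = {e \<in> ?U. \<exists>p v. awalk s (p @ [e]) v \<and> set p \<inter> ?U = {}}"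
  define Y where "Y = {e \<in> ?U. \<exists>p v. awalk (tail G e) (e # p) v \<and>
    last (e # p) \<in> A \<and> set p \<inter> ?U = {}}"
  have X: "set p \<inter> X \<noteq> {}" if "awalk s p v" "set p \<inter> ?U \<noteq> {}" for p v
  proof -
    have "\<exists>e\<in>set p. e \<in> ?U" using that(2) by blast
    from split_list_first_prop[OF this]
    obtain q e q' where pq: "p = q @ e # q'" and e: "e \<in> ?U" and "\<forall>x\<in>set q. x \<notin> ?U"
      by blast
    moreover have "awalk s ((q @ [e]) @ q') v" using that(1) pq by simp
    then have "awalk s (q @ [e]) (awlast s (q @ [e]))" using awalk_append_iff by blast
    ultimately have "e \<in> X" by (auto simp: X_def simp del: awalk_append_iff)
    then show ?thesis by (auto simp: pq)
  qed
  have Y: "set p \<inter> Y \<noteq> {}" if p: "awalk s p v" "p \<noteq> []" "last p \<in> A" for p v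
  proof -
    have "\<exists>e\<in>set p. e \<in> ?U" using is_cutD[OF cutC p] by blast
    from split_list_last_prop[OF this]
    obtain q e q' where pq: "p = q @ e # q'" and e: "e \<in> ?U" and "\<forall>x\<in>set q'. x \<notin> ?U"
      by blast
    moreover have "awalk (tail G e) (e # q') v"
      using that(1) pq by (auto simp: awalk_Cons_iff)
    moreover have "last (e # q') \<in> A" using p(3) pq by (simp split: if_splits)
    ultimately have "e \<in> Y" unfolding Y_def by blast
    then show ?thesis by (auto simp: pq)
  qed
  have XU: "X \<subseteq> ?U" and YU: "Y \<subseteq> ?U" by (auto simp: X_def Y_def)
  have arcsU: "?U \<subseteq> arcs G" using cutC cutD is_cut_subset by blast
  \<comment> \<open>The set \<open>B\<close> stays arbitrary because the fact is used for
    \<open>A\<close>, \<open>C\<close> and \<open>D\<close>.\<close>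
  have cutX: "is_cut B X" if "is_cut B C \<or> is_cut B D" for B
  proof (rule is_cutI)
    fix p v assume "awalk s p v" "p \<noteq> []" "last p \<in> B"
    then have "set p \<inter> ?U \<noteq> {}" using that is_cutD by blast
    then show "set p \<inter> X \<noteq> {}" using X \<open>awalk s p v\<close> by blast
  qed (use XU arcsU in blast)
  have cutY: "is_cut A Y" by (rule is_cutI) (use YU arcsU Y in blast)+
  have "X \<inter> Y \<subseteq> C \<inter> D"
  proof
    fix e assume "e \<in> X \<inter> Y"
    then obtain p v q w where p: "awalk s (p @ [e]) v" "set p \<inter> ?U = {}"
      and q: "awalk (tail G e) (e # q) w" "last (e # q) \<in> A" "set q \<inter> ?U = {}"
      unfolding X_def Y_def by blast
    \<comment> \<open>The joined walk meets \<open>?U\<close> only in \<open>e\<close>, so both cuts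
      must contain \<open>e\<close>.\<close>
    have "awalk s (p @ e # q) w"
      using p(1) q(1) by (auto simp: awalk_Cons_iff)
    moreover have "last (p @ e # q) \<in> A" using q(2) by simp
    ultimately have "set (p @ e # q) \<inter> C \<noteq> {}" "set (p @ e # q) \<inter> D \<noteq> {}"
      using is_cutD[OF cutC] is_cutD[OF cutD] by blast+
    then show "e \<in> C \<inter> D" using p(2) q(3) by auto
  qed
  then have "card (X \<inter> Y) \<le> card (C \<inter> D)" using fin by (intro card_mono) auto
  moreover have "card (X \<union> Y) \<le> card ?U" using XU YU fin by (intro card_mono) auto
  moreover have "finite X" "finite Y" using XU YU fin finite_subset by blast+
  ultimately have "card X + card Y \<le> card C + card D"
    using card_Un_Int[of X Y] card_Un_Int[of C D] fin by simp
  \<comment> \<open>Since \<open>Y\<close> is a cut for \<open>A\<close>, it is at least as large as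
    the minimum cut \<open>D\<close>; the joint bound then forces \<open>X\<close> to be no larger
    than \<open>C\<close>.\<close>
  moreover have "card D \<le> card Y" "card C \<le> card D"
    using C D cutY by (simp_all add: is_min_cut_def)
  ultimately have "card X \<le> card C" by simp
  then have "is_min_cut A X"
    using C cutX cutC unfolding is_min_cut_def by (meson order_trans)
  moreover have "is_cut C X" "is_cut D X"
    using cutX is_cut_refl arcsU by auto
  ultimately show thesis by (rule that)
qed

text \<open>There are finitely many minimum cuts. Uncrossing them one after another yields a minimum
  cut that separates the source from all of them.\<close>

lemma primary_min_cut_exists:
  assumes "A \<subseteq> arcs G"
  obtains C where "is_primary_min_cut A C"
proof -
  have common: "\<exists>C. is_min_cut A C \<and> (\<forall>C'\<in>F. is_cut C' C)"
    if "finite F" "F \<subseteq> Collect (is_min_cut A)" for F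
    using that
  proof induction
    case empty
    then show ?case using is_min_cut_exists[OF assms] by blast
  next
    case (insert D F)
    then obtain C where C: "is_min_cut A C" "\<forall>C'\<in>F. is_cut C' C" by auto
    moreover have "is_min_cut A D" using insert.prems by simp
    ultimately obtain X where "is_min_cut A X" "is_cut C X" "is_cut D X"
      using min_cut_uncross by blast
    with C(2) show ?case using is_cut_trans by blast
  qed
  have "Collect (is_min_cut A) \<subseteq> Pow (arcs G)"
    by (auto simp: is_min_cut_def is_cut_def)
  then have "finite (Collect (is_min_cut A))"
    by (rule finite_subset) simp
  from common[OF this subset_refl]
  obtain C where "is_min_cut A C" "\<forall>C'. is_min_cut A C' \<longrightarrow> is_cut C' C"
    by blast
  then show thesis using that by (simp add: is_primary_min_cut_def)
qed

text \<open>By transitivity, every minimum cut for \<open>C\<close> is also a minimum cut for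
  \<open>A\<close>, so \<open>C\<close> separates the source from it.\<close>

lemma primary_min_cut_is_primary:
  assumes "is_primary_min_cut A C"
  shows "is_primary_min_cut C C"
proof -
  have C: "is_cut A C" "\<And>D. is_cut A D \<Longrightarrow> card C \<le> card D"
    and prim: "\<And>D. is_min_cut A D \<Longrightarrow> is_cut D C"
    using assms by (auto simp: is_primary_min_cut_def is_min_cut_def)
  have "is_cut C C" using is_cut_refl is_cut_subset[OF C(1)] by blast
  moreover have "is_min_cut A D" if "is_min_cut C D" for D
    using that C is_cut_trans[OF C(1)] \<open>is_cut C C\<close> unfolding is_min_cut_def
    by (meson order_trans)
  moreover have "is_min_cut C C"
    using \<open>is_cut C C\<close> C is_cut_trans[OF C(1)] by (auto simp: is_min_cut_def)
  ultimately show ?thesis using prim by (simp add: is_primary_min_cut_def)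
qed

section \<open>Primary sets of prescribed size\<close>

text \<open>The primary minimum cut has the same size as \<open>C\<close> and is itself a primary
  set.\<close>

lemma primary_sets_nonempty_if_min_cut:
  assumes "A \<subseteq> arcs G" "is_min_cut A C"
  shows "primary_sets (card C) \<noteq> {}"
proof -
  obtain P where P: "is_primary_min_cut A P" using primary_min_cut_exists[OF assms(1)] .
  then have "card P = card C" "P \<subseteq> arcs G"
    using assms(2) is_cut_subset by (auto simp: is_primary_min_cut_def is_min_cut_def le_antisym)
  then show ?thesis
    using primary_min_cut_is_primary[OF P] by (auto simp: primary_sets_def)
qed

text \<open>Adding an edge to \<open>A\<close> raises the size of a minimum cut by at most one, so every value up to
  the size for \<open>A\<close> occurs for a subset of \<open>A\<close>.\<close>

lemma subset_with_min_cut_card: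
  assumes "finite A" "A \<subseteq> arcs G" "\<And>C. is_cut A C \<Longrightarrow> r \<le> card C"
  obtains B C where "B \<subseteq> A" "is_min_cut B C" "card C = r"
proof -
  have "\<exists>B\<subseteq>A. \<exists>C. is_min_cut B C \<and> card C = r"
    using assms
  proof induction
    case empty
    have "is_cut {} {}" by (rule is_cutI) auto
    then have "is_min_cut {} {}" "r = 0" using empty by (fastforce simp: is_min_cut_def)+
    then show ?case by auto
  next
    case (insert e A)
    show ?case
    proof (cases "\<forall>C. is_cut A C \<longrightarrow> r \<le> card C")
      case True
      then show ?thesis using insert by blast
    next
      case False
      \<comment> \<open>Here the minimum jumps to at least \<open>r\<close> exactly when
        \<open>e\<close> is added. As \<open>insert e D\<close> has at most \<open>r\<close> edges,
        the minimum cut for \<open>insert e A\<close> has exactly \<open>r\<close>.\<close>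
      then obtain D where D: "is_cut A D" "card D < r" by auto
      obtain C where C: "is_min_cut (insert e A) C"
        using is_min_cut_exists insert.prems(1) by blast
      have "is_cut (insert e A) (insert e D)"
      proof (rule is_cutI)
        show "insert e D \<subseteq> arcs G" using insert.prems(1) is_cut_subset[OF D(1)] by auto
      next
        fix p v assume "awalk s p v" "p \<noteq> []" "last p \<in> insert e A"
        then show "set p \<inter> insert e D \<noteq> {}"
          using is_cutD[OF D(1), of p v] last_in_set[of p] by (cases "last p = e") auto
      qed
      then have "card C \<le> card (insert e D)" using C by (simp add: is_min_cut_def)
      also have "\<dots> \<le> Suc (card D)" by (simp add: card_insert_if finite_cut[OF D(1)])
      finally have "card C \<le> r" using D(2) by simp
      moreover have "r \<le> card C" using C insert.prems(2) by (simp add: is_min_cut_def)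
      ultimately show ?thesis using C by auto
    qed
  qed
  then show thesis using that by blast
qed

text \<open>A walk from \<open>s\<close> to \<open>t\<close> that survives the deletion of
  \<open>C\<close> is nonempty, since a sink differs from \<open>s\<close>, and its last edge enters
  \<open>t\<close>. It would therefore avoid a cut for \<open>in_arcs G t\<close>.\<close>

lemma cut_capacity_le_card_cut:
  assumes "t \<in> T" "is_cut (in_arcs G t) C"
  shows "cut_capacity t \<le> card C"
proof -
  let ?H = "G\<lparr>arcs := arcs G - C\<rparr>"
  have "\<not> s \<rightarrow>\<^sup>*\<^bsub>?H\<^esub> t"
  proof
    assume reach: "s \<rightarrow>\<^sup>*\<^bsub>?H\<^esub> t"
    interpret H: wf_digraph ?H by unfold_locales (auto intro: wellformed)
    obtain p where p: "H.awalk s p t" using reach H.reachable_awalk by blast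
    \<comment> \<open>Deleting arcs changes neither heads nor tails, so chaining of arcs is the same
      in both graphs.\<close>
    have cas: "H.cas u q v \<longleftrightarrow> cas u q v" for u q v
      by (induction q arbitrary: u) (simp_all add: H.cas.simps)
    have walk: "awalk s p t" "set p \<inter> C = {}"
      using p by (auto simp: H.awalk_def awalk_def cas)
    have "p \<noteq> []" using walk(1) assms(1) sinks_subset by (auto simp: awalk_Nil_iff)
    moreover from this have "last p \<in> in_arcs G t"
      using walk(1) by (cases p rule: rev_cases) (auto simp: awalk_Cons_iff awalk_Nil_iff)
    ultimately show False using is_cutD[OF assms(2) walk(1)] walk(2) by blast
  qed
  then show ?thesis
    unfolding cut_capacity_def using is_cut_subset[OF assms(2)] by (intro Least_le) blast
qed

lemma primary_sets_nonempty:
  assumes "r \<le> min_cut_capacity"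
  shows "primary_sets r \<noteq> {}"
proof -
  obtain t where t: "t \<in> T" using sinks_nonempty by blast
  have "finite T" using sinks_subset finite_verts finite_subset by blast
  then have "min_cut_capacity \<le> cut_capacity t" using t by (simp add: min_cut_capacity_def)
  then have "r \<le> card C" if "is_cut (in_arcs G t) C" for C
    using assms cut_capacity_le_card_cut[OF t that] by simp
  moreover have "in_arcs G t \<subseteq> arcs G" by (auto simp: in_arcs_def)
  moreover from this have "finite (in_arcs G t)" by (rule finite_subset) simp
  ultimately obtain B C where "B \<subseteq> in_arcs G t" "is_min_cut B C" "card C = r"
    using subset_with_min_cut_card by blast
  then show ?thesis
    using primary_sets_nonempty_if_min_cut[of B C] \<open>in_arcs G t \<subseteq> arcs G\<close> by blast
qed

lemma finite_primary_sets: "finite (primary_sets r)"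
  by (rule finite_subset[of _ "Pow (arcs G)"]) (auto simp: primary_sets_def)

lemma global_kernel_carrier: "global_kernel n K d \<in> carrier_vec n"
proof (induction n K d rule: global_kernel.induct)
  case (1 n K i)
  then show ?case by simp
next
  case (2 n K e)
  then show ?case by (auto intro!: finsum_vec_closed)
qed

end

section \<open>Reduction of the dimension\<close>

theorem theorem6:
  fixes G :: "('v, 'e) pre_digraph" and s :: 'v and T :: "'v set"
    and \<omega> r n :: nat
    and K :: "'v \<Rightarrow> 'e in_edge \<Rightarrow> 'e \<Rightarrow> 'q::{field, finite}"
    and Q :: "'q mat"
    and b b' :: "nat \<Rightarrow> 'q vec" and f f' :: "'e \<Rightarrow> 'q vec"
    and \<A> \<A>' \<A>'' :: "'e set set"
    and \<K> :: "'e set \<Rightarrow> 'q vec set" and S :: "'q vec set"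
  assumes "network G s T"
    and "\<omega> \<ge> 1" and "n = \<omega> + r" and "n \<le> network.min_cut_capacity G s T"
    and "\<A> = network.primary_sets G s r"
    and "card (UNIV :: 'q set) > card \<A>"
    and "network.decodable G s T n K"
    and "f = (\<lambda>e. network.global_kernel G s n K (Edge e))"
    and "Q \<in> carrier_mat n n" and "invertible_mat Q"
    and "b = col Q"
    and "\<And>A. A \<in> \<A> \<Longrightarrow> vspan n (b ` {..<\<omega>}) \<inter> vspan n (f ` A) = {0\<^sub>v n}"
    and "b' = (\<lambda>i. vec_first (b i) (n - 1))"
    and "f' = (\<lambda>e. vec_first (f e) (n - 1))"
    and "lin_indpt_family (n - 1) b' {..<\<omega> - 1}"
    and "\<A>' = {A \<in> \<A>. \<not> lin_indpt_family (n - 1) (case_sum b' f') ({..<\<omega> - 1} <+> A)}"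
    and "\<A>'' = {A \<in> \<A>. lin_indpt_family (n - 1) (case_sum b' f') ({..<\<omega> - 1} <+> A)}"
    and "\<K> = (\<lambda>A. {vsum (n - 1) (\<lambda>i. \<alpha> i \<cdot>\<^sub>v b' i) {..<\<omega> - 1} + vsum (n - 1) (\<lambda>e. \<beta> e \<cdot>\<^sub>v f' e) A | \<alpha> \<beta>.
           (\<Sum>i<\<omega> - 1. \<alpha> i * b i $ (n - 1)) + (\<Sum>e\<in>A. \<beta> e * f e $ (n - 1)) = - 1})"
    and "S = carrier_vec (n - 1) -
           ((\<Union>A \<in> \<A>'. {x + y | x y. x \<in> vspan (n - 1) (b' ` {..<\<omega> - 1}) \<and> y \<in> vspan (n - 1) (f' ` A)})
            \<union> (\<Union>A \<in> \<A>''. \<K> A))"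
  shows "S \<noteq> {} \<and>
    (\<forall>l \<in> S.
      (let M = mat_of_cols (n - 1) (cols (1\<^sub>m (n - 1)) @ [l]);
           bl = (\<lambda>i. M *\<^sub>v b i);
           fl = (\<lambda>e. M *\<^sub>v f e)
       in lin_indpt_family (n - 1) bl {..<\<omega> - 1} \<and>
          (\<forall>A \<in> \<A>. vspan (n - 1) (bl ` {..<\<omega> - 1}) \<inter> vspan (n - 1) (fl ` A) = {0\<^sub>v (n - 1)})))"
proof -
  interpret network G s T by (rule assms(1))
  define m where "m = n - 1"
  have n: "n = Suc m" and m: "m = (\<omega> - 1) + r" using assms(2,3) by (simp_all add: m_def)
  have finA: "finite \<A>" using assms(5) finite_primary_sets by simp
  have "\<A> \<noteq> {}" using primary_sets_nonempty[of r] assms(3-5) by simp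
  have A: "finite A" "card A = r" if "A \<in> \<A>" for A
    using that assms(5) finite_subset[of A "arcs G"] by (auto simp: primary_sets_def)
  have f: "f e \<in> carrier_vec n" for e
    unfolding assms(8) by (rule global_kernel_carrier)
  have b: "b i \<in> carrier_vec n" for i
    using assms(9,11) by auto
  have b': "b' i \<in> carrier_vec m" and f': "f' e \<in> carrier_vec m" for i e
    unfolding assms(13,14) m_def by simp_all
  have b'_index: "b' i $ k = b i $ k" and f'_index: "f' e $ k = f e $ k" if "k < m" for i e k
    using that unfolding assms(13,14) m_def by (simp_all add: vec_first_def)
  define B where "B = {..<\<omega> - 1}"
  have B: "finite B" "card B = \<omega> - 1" "B \<subseteq> {..<\<omega>}" by (auto simp: B_def)
  \<comment> \<open>The vectors for \<open>B\<close> and \<open>A\<close> form one family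
    \<open>v\<close> over a disjoint sum, with last components \<open>c\<close>. The projection then
    sends index \<open>j\<close> to \<open>v j + c j \<cdot>\<^sub>v l\<close>.\<close>
  define J where "J A = B <+> A" for A :: "'e set"
  define v where "v = case_sum b' f'"
  define c where "c = case_sum (\<lambda>i. b i $ m) (\<lambda>e. f e $ m)"
  have v: "v \<in> X \<rightarrow> carrier_vec m" for X
    using b' f' by (auto simp: v_def split: sum.split)
  have J: "finite (J A)" "card (J A) = m" if "A \<in> \<A>" for A
    using A[OF that] B m by (simp_all add: J_def card_Plus)
  have v_Plus: "lin_comb m v a (J A) = lin_comb m b' (a \<circ> Inl) B + lin_comb m f' (a \<circ> Inr) A"
    if "A \<in> \<A>" for a A
    unfolding v_def J_def using A(1)[OF that] B(1) by (simp add: lin_comb_Plus)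
  have c_Plus: "(\<Sum>j\<in>J A. a j * c j) =
      (\<Sum>i\<in>B. a (Inl i) * b i $ m) + (\<Sum>e\<in>A. a (Inr e) * f e $ m)" if "A \<in> \<A>" for a A
    unfolding c_def J_def using A(1)[OF that] B(1) by (simp add: sum.Plus)
  have spanB: "vspan m (b' ` B) = range (\<lambda>a. lin_comb m b' a B)"
    using b' B(1) by (intro span_image_eq_lin_comb) auto
  have spanA: "vspan m (f' ` A) = range (\<lambda>a. lin_comb m f' a A)" if "A \<in> \<A>" for A
    using f' A(1)[OF that] by (intro span_image_eq_lin_comb) auto
  have sum_spans: "{x + y | x y. x \<in> vspan m (b' ` B) \<and> y \<in> vspan m (f' ` A)} =
      range (\<lambda>a. lin_comb m v a (J A))" if AA: "A \<in> \<A>" for A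
  proof (intro equalityI subsetI)
    fix x assume "x \<in> {x + y | x y. x \<in> vspan m (b' ` B) \<and> y \<in> vspan m (f' ` A)}"
    then obtain a a' where "x = lin_comb m b' a B + lin_comb m f' a' A"
      unfolding spanB spanA[OF AA] by blast
    then have "x = lin_comb m v (case_sum a a') (J A)"
      by (simp add: v_Plus[OF AA] comp_def)
    then show "x \<in> range (\<lambda>a. lin_comb m v a (J A))" by blast
  next
    fix x assume "x \<in> range (\<lambda>a. lin_comb m v a (J A))"
    then show "x \<in> {x + y | x y. x \<in> vspan m (b' ` B) \<and> y \<in> vspan m (f' ` A)}"
      unfolding spanB spanA[OF AA] v_Plus[OF AA] by blast
  qed
  have \<K>: "\<K> A = {lin_comb m v a (J A) | a. (\<Sum>j\<in>J A. a j * c j) = - 1}" if AA: "A \<in> \<A>" for A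
  proof -
    have "\<K> A = {lin_comb m b' \<alpha> B + lin_comb m f' \<beta> A | \<alpha> \<beta>.
        (\<Sum>i\<in>B. \<alpha> i * b i $ m) + (\<Sum>e\<in>A. \<beta> e * f e $ m) = - 1}"
      unfolding assms(18) m_def[symmetric] B_def[symmetric]
      using b' f' A(1)[OF AA] B(1) by (simp add: vsum_eq_lin_comb)
    also have "\<dots> = {lin_comb m v a (J A) | a. (\<Sum>j\<in>J A. a j * c j) = - 1}"
    proof (intro equalityI subsetI)
      fix x assume "x \<in> {lin_comb m b' \<alpha> B + lin_comb m f' \<beta> A | \<alpha> \<beta>.
        (\<Sum>i\<in>B. \<alpha> i * b i $ m) + (\<Sum>e\<in>A. \<beta> e * f e $ m) = - 1}"
      then obtain \<alpha> \<beta> where x: "x = lin_comb m b' \<alpha> B + lin_comb m f' \<beta> A"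
        and eq: "(\<Sum>i\<in>B. \<alpha> i * b i $ m) + (\<Sum>e\<in>A. \<beta> e * f e $ m) = - 1"
        by blast
      have "x = lin_comb m v (case_sum \<alpha> \<beta>) (J A)"
        by (simp add: x v_Plus[OF AA] comp_def)
      moreover have "(\<Sum>j\<in>J A. case_sum \<alpha> \<beta> j * c j) = - 1"
        by (simp add: c_Plus[OF AA] eq)
      ultimately show "x \<in> {lin_comb m v a (J A) | a. (\<Sum>j\<in>J A. a j * c j) = - 1}" by blast
    next
      fix x assume "x \<in> {lin_comb m v a (J A) | a. (\<Sum>j\<in>J A. a j * c j) = - 1}"
      then obtain a where x: "x = lin_comb m v a (J A)" and "(\<Sum>j\<in>J A. a j * c j) = - 1"
        by blast
      then have "(\<Sum>i\<in>B. (a \<circ> Inl) i * b i $ m) + (\<Sum>e\<in>A. (a \<circ> Inr) e * f e $ m) = - 1"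
        by (simp add: c_Plus[OF AA])
      then show "x \<in> {lin_comb m b' \<alpha> B + lin_comb m f' \<beta> A | \<alpha> \<beta>.
        (\<Sum>i\<in>B. \<alpha> i * b i $ m) + (\<Sum>e\<in>A. \<beta> e * f e $ m) = - 1}"
        unfolding x v_Plus[OF AA] by blast
    qed
    finally show ?thesis .
  qed
  \<comment> \<open>Merging the two kinds of excluded sets gives one set per element of
    \<open>\<A>\<close>, so a single covering bound handles both.\<close>
  define X where "X A = (if lin_indpt_family m v (J A) then \<K> A
    else range (\<lambda>a. lin_comb m v a (J A)))" for A
  have S: "S = carrier_vec m - (\<Union>A\<in>\<A>. X A)"
  proof -
    have "(\<Union>A\<in>\<A>'. {x + y | x y. x \<in> vspan m (b' ` B) \<and> y \<in> vspan m (f' ` A)}) =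
        (\<Union>A\<in>\<A>'. X A)"
      using sum_spans unfolding assms(16) m_def[symmetric] B_def[symmetric]
      by (intro SUP_cong refl) (simp add: X_def v_def J_def)
    moreover have "(\<Union>A\<in>\<A>''. \<K> A) = (\<Union>A\<in>\<A>''. X A)"
      unfolding assms(17) m_def[symmetric] B_def[symmetric]
      by (intro SUP_cong refl) (simp add: X_def v_def J_def)
    moreover have "\<A> = \<A>' \<union> \<A>''" unfolding assms(16,17) by blast
    ultimately show ?thesis unfolding assms(19) m_def[symmetric] B_def[symmetric] by (simp add: UN_Un)
  qed
  have "card (X A) * CARD('q) \<le> CARD('q) ^ m" if "A \<in> \<A>" for A
    using card_lin_comb_hyperplane[OF J(1)[OF that], where d = "- 1" and v = v and c = c and m = m]
      card_range_lin_comb_dependent[OF J(1)[OF that] v] J(2)[OF that]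
    by (simp add: X_def \<K>[OF that])
  moreover have "X A \<subseteq> carrier_vec m" if "A \<in> \<A>" for A
    by (auto simp: X_def \<K>[OF that])
  ultimately have "S \<noteq> {}"
    unfolding S using finA assms(6) by (intro carrier_vec_not_covered) auto
  moreover have "lin_indpt_family m bl B \<and>
      (\<forall>A\<in>\<A>. vspan m (bl ` B) \<inter> vspan m (fl ` A) = {0\<^sub>v m})"
    if "l \<in> S" and bl: "bl = (\<lambda>i. mat_of_cols m (cols (1\<^sub>m m) @ [l]) *\<^sub>v b i)"
      and fl: "fl = (\<lambda>e. mat_of_cols m (cols (1\<^sub>m m) @ [l]) *\<^sub>v f e)" for l bl fl
  proof -
    have lX: "l \<notin> X A" if "A \<in> \<A>" for A
      using \<open>l \<in> S\<close> that by (auto simp: S)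
    have l: "l \<in> carrier_vec m" using \<open>l \<in> S\<close> by (simp add: S)
    have bl_eq: "bl = (\<lambda>i. b' i + b i $ m \<cdot>\<^sub>v l)" and fl_eq: "fl = (\<lambda>e. f' e + f e $ m \<cdot>\<^sub>v l)"
      using b f l unfolding bl fl assms(13,14) m_def[symmetric] n
      by (simp_all add: mat_of_cols_one_append_mult_vec)
    have case_eq: "case_sum bl fl = (\<lambda>j. v j + c j \<cdot>\<^sub>v l)"
      by (auto simp: bl_eq fl_eq v_def c_def split: sum.split)
    have blc: "bl \<in> Y \<rightarrow> carrier_vec m" and flc: "fl \<in> Z \<rightarrow> carrier_vec m" for Y Z
      using b' f' l by (simp_all add: bl_eq fl_eq)
    \<comment> \<open>This serves both conclusions: \<open>\<beta> = 0\<close> gives independence of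
      the projected vectors, and arbitrary \<beta> gives the trivial intersection.\<close>
    have main: "(\<forall>i\<in>B. \<alpha> i = 0) \<and> lin_comb m bl \<alpha> B = 0\<^sub>v m"
      if AA: "A \<in> \<A>" and eq: "lin_comb m bl \<alpha> B = lin_comb m fl \<beta> A" for A \<alpha> \<beta>
    proof -
      let ?w = "case_sum \<alpha> (\<lambda>e. - \<beta> e)"
      have "lin_comb m (case_sum bl fl) ?w (J A) =
          lin_comb m bl \<alpha> B + - lin_comb m fl \<beta> A"
        using A(1)[OF AA] B(1) by (simp add: J_def lin_comb_Plus comp_def lin_comb_uminus)
      also have "\<dots> = 0\<^sub>v m" unfolding eq by (intro eq_vecI) auto
      finally have zero: "lin_comb m (\<lambda>j. v j + c j \<cdot>\<^sub>v l) ?w (J A) = 0\<^sub>v m"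
        by (simp only: case_eq)
      have "\<forall>i\<in>B. \<alpha> i = 0"
      proof (cases "lin_indpt_family m v (J A)")
        case True
        then have "lin_indpt_family m (\<lambda>j. v j + c j \<cdot>\<^sub>v l) (J A)"
          using lX[OF AA] l J[OF AA] v \<K>[OF AA]
          by (intro lin_indpt_family_add_smult) (auto simp: X_def)
        moreover have "(\<lambda>j. v j + c j \<cdot>\<^sub>v l) \<in> J A \<rightarrow> carrier_vec m"
          using v l by (simp add: Pi_iff)
        ultimately have w0: "\<forall>j\<in>J A. ?w j = 0"
          using zero J(1)[OF AA] lin_indpt_family_iff_lin_comb by blast
        show ?thesis
        proof
          fix i assume "i \<in> B"
          then have "Inl i \<in> J A" unfolding J_def by (rule InlI)
          from bspec[OF w0 this] show "\<alpha> i = 0" by simp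
        qed
      next
        case False
        then have "l \<notin> range (\<lambda>a. lin_comb m v a (J A))"
          using lX[OF AA] by (simp add: X_def)
        from lin_comb_add_smult_eq_zeroD[OF v l this zero]
        have vzero: "lin_comb m v ?w (J A) = 0\<^sub>v m" and czero: "(\<Sum>j\<in>J A. ?w j * c j) = 0"
          by simp_all
        \<comment> \<open>The equation lifts to dimension \<open>n\<close>: \<open>vzero\<close>
          supplies the first \<open>m\<close> components and \<open>czero\<close> the last
          one.\<close>
        have eq_n: "lin_comb n b \<alpha> B = lin_comb n f \<beta> A"
        proof (rule eq_vecI)
          fix k assume "k < dim_vec (lin_comb n f \<beta> A)"
          then have "k < m \<or> k = m" by (auto simp: n)
          then consider "k < m" | "k = m" by blast
          then have "(\<Sum>i\<in>B. \<alpha> i * b i $ k) = (\<Sum>e\<in>A. \<beta> e * f e $ k)"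
          proof cases
            case 1
            then have "lin_comb m v ?w (J A) $ k = 0" by (simp add: vzero del: lin_comb_index)
            then show ?thesis
              using 1 by (simp add: v_Plus[OF AA] b'_index f'_index sum_negf)
          next
            case 2
            then show ?thesis using czero by (simp add: c_Plus[OF AA] sum_negf)
          qed
          then show "lin_comb n b \<alpha> B $ k = lin_comb n f \<beta> A $ k"
            using \<open>k < _\<close> by simp
        qed simp
        \<comment> \<open>The intersection hypothesis concerns all \<omega> vectors, while
          \<open>B\<close> indexes only the first \<omega> - 1; the missing coefficient is set to
          zero.\<close>
        have "lin_comb n b \<alpha> B = lin_comb n b (\<lambda>i. if i \<in> B then \<alpha> i else 0) {..<\<omega>}"
          unfolding lin_comb_def
          using B by (intro arg_cong2[where f = vec] ext refl sum.mono_neutral_cong_left) auto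
        also have "\<dots> \<in> vspan n (b ` {..<\<omega>})"
          using b by (subst span_image_eq_lin_comb) auto
        finally have "lin_comb n b \<alpha> B \<in> vspan n (b ` {..<\<omega>})" .
        moreover have "lin_comb n b \<alpha> B \<in> vspan n (f ` A)"
          using f A(1)[OF AA] unfolding eq_n by (subst span_image_eq_lin_comb) auto
        ultimately have bzero: "lin_comb n b \<alpha> B = 0\<^sub>v n"
          using assms(12)[OF AA] by blast
        \<comment> \<open>Truncating the relation in dimension \<open>n\<close> gives one among the
          \<open>b'\<close>, whose assumed independence makes every \<alpha> coefficient
          vanish.\<close>
        have "lin_comb m b' \<alpha> B = 0\<^sub>v m"
        proof (rule eq_vecI)
          fix k assume "k < dim_vec (0\<^sub>v m :: 'q vec)"
          then have k: "k < m" by simp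
          then have kn: "k < n" by (simp add: n)
          then have "lin_comb n b \<alpha> B $ k = 0" by (simp add: bzero del: lin_comb_index)
          then show "lin_comb m b' \<alpha> B $ k = 0\<^sub>v m $ k"
            using k kn by (simp add: b'_index)
        qed simp
        moreover have "b' \<in> B \<rightarrow> carrier_vec m" using b' by blast
        ultimately show ?thesis
          using B(1) assms(15) lin_indpt_family_iff_lin_comb[of B b' m]
          unfolding m_def[symmetric] B_def[symmetric] by blast
      qed
      moreover from this have "lin_comb m bl \<alpha> B = 0\<^sub>v m"
        by (intro eq_vecI) simp_all
      ultimately show ?thesis by blast
    qed
    have "lin_indpt_family m bl B"
    proof -
      \<comment> \<open>Conclusion (1) mentions no edge set, yet the constraints on \<open>l\<close>
        come only from members of \<open>\<A>\<close>; any one of them suffices.\<close>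
      obtain A where AA: "A \<in> \<A>" using \<open>\<A> \<noteq> {}\<close> by blast
      have "lin_comb m fl (\<lambda>e. 0) A = 0\<^sub>v m" by (intro eq_vecI) simp_all
      then have "\<forall>i\<in>B. \<alpha> i = 0" if "lin_comb m bl \<alpha> B = 0\<^sub>v m" for \<alpha>
        using main[OF AA] that by metis
      then show ?thesis using blc B(1) by (simp add: lin_indpt_family_iff_lin_comb)
    qed
    moreover have "vspan m (bl ` B) \<inter> vspan m (fl ` A) = {0\<^sub>v m}" if AA: "A \<in> \<A>" for A
    proof -
      have eq: "vspan m (bl ` B) = range (\<lambda>a. lin_comb m bl a B)"
        "vspan m (fl ` A) = range (\<lambda>a. lin_comb m fl a A)"
        using blc flc A(1)[OF AA] B(1) by (simp_all add: span_image_eq_lin_comb)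
      have "0\<^sub>v m = lin_comb m bl (\<lambda>i. 0) B" "0\<^sub>v m = lin_comb m fl (\<lambda>e. 0) A"
        by (intro eq_vecI; simp)+
      then have "0\<^sub>v m \<in> vspan m (bl ` B) \<inter> vspan m (fl ` A)"
        unfolding eq by (intro IntI range_eqI)
      moreover have "x = 0\<^sub>v m" if "x \<in> vspan m (bl ` B) \<inter> vspan m (fl ` A)" for x
        using that main[OF AA] unfolding eq by blast
      ultimately show ?thesis by blast
    qed
    ultimately show ?thesis by blast
  qed
  ultimately show ?thesis by (simp add: Let_def m_def B_def)
qed

end
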